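(* Let $\gamma$ be a smooth oval in $\mathbb{R}^2$, let $\alpha\in(0,1)$, and let $p_1=\gamma_1(t)$, $p_2=\gamma_2(s)$ be two distinct points of $\gamma$ whose tangent lines are not parallel. The necessary and sufficient condition for the pair $(s,t)$ to determine a point of the envelope of intermediate lines (i.e. for there to exist $X\in\mathbb{R}^2$ with $F=F_s=F_t=0$ at $(s,t,X)$) is $$\nu_1(C)=-\lambda\,\nu_2(C),\qquad\text{where } \lambda=\left(\frac{1-\alpha}{\alpha}\right)^{1/3}.$$
   Context: Notation: $[\cdot,\cdot]$ is the determinant of two vectors of $\mathbb{R}^2$. An oval is a smooth closed convex plane curve without inflection points. $\gamma_1(t)$ and $\gamma_2(s)$ are regular local parametrizations of $\gamma$ around $p_1$ and $p_2$ respectively. The affine normal of a curve without inflections is $\xi=\gamma_{\sigma\sigma}$, where $\sigma$ is an affine arc length parameter, i.e. $[\gamma_\sigma,\gamma_{\sigma\sigma}]=1$. The co-normal map assigns to $p\in\gamma$ the linear functional $\nu(p)$ on $\mathbb{R}^2$ with $\nu(p)(\xi)=1$ and $\nu(p)(T)=0$ for every $T$ tangent to $\gamma$ at $p$; equivalently, for any regular parametrization, $\nu(U)=[\gamma',U]/[\gamma',\gamma'']^{1/3}$. Put $\nu_1=\nu(\gamma_1(t))$, $\nu_2=\nu(\gamma_2(s))$, $C=\gamma_2(s)-\gamma_1(t)$ (the chord) and $M_\alpha=(1-\alpha)\gamma_1(t)+\alpha\gamma_2(s)$ (the intermediate point). The intermediate line of the pair is the line through $M_\alpha$ and the intersection point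 of the two tangent lines; its equation is $F(s,t,X)=0$ with $$F(s,t,X)=(1-\alpha)\,\nu_2(C)\,\nu_1(X-M_\alpha)+\alpha\,\nu_1(C)\,\nu_2(X-M_\alpha).$$ The envelope of intermediate lines is the set of $X\in\mathbb{R}^2$ for which there is $(s,t)$ with $F=F_s=F_t=0$ at $(s,t,X)$.
   Formalization: Sufficiency is claimed only if no nonzero direction U annihilates the X-linear parts of F, F_s and F_t at (s,t) (no envelope point at infinity); without this it fails, e.g. α=1/2 and two points on a parabolic arc of the oval. Necessity is unrestricted. *)

theory Defs
  imports "HOL-Analysis.Analysis"
begin

definition bracket :: "real^2 \<Rightarrow> real^2 \<Rightarrow> real" where
  "bracket u v = det (vector [u, v] :: real^2^2)"

lemma bracket_eq: "bracket u v = u $ 1 * v $ 2 - u $ 2 * v $ 1"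
  by (simp add: bracket_def det_2 vector_2)

definition cderiv :: "(real \<Rightarrow> real^2) \<Rightarrow> real \<Rightarrow> real^2" where
  "cderiv g t = vector_derivative g (at t)"

text \<open>Infinitely differentiable; only meant for open \<open>I\<close>, where the two-sided
  derivatives at points of \<open>I\<close> depend only on the restriction of \<open>g\<close> to \<open>I\<close>.\<close>
definition smooth_curve_on :: "real set \<Rightarrow> (real \<Rightarrow> real^2) \<Rightarrow> bool" where
  "smooth_curve_on I g \<longleftrightarrow> (\<forall>n. \<forall>t\<in>I. ((cderiv ^^ n) g) differentiable (at t))"

text \<open>An oval is the trace of a smooth simple closed regular curve \<open>c\<close> of period \<open>L\<close>
  that bounds a convex region and has no inflection points.\<close>
definition smooth_oval :: "(real^2) set \<Rightarrow> bool" where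
  "smooth_oval S \<longleftrightarrow>
    (\<exists>c L. L > 0 \<and> smooth_curve_on UNIV c \<and> (\<forall>x. c (x + L) = c x) \<and> inj_on c {0..<L} \<and>
       (\<forall>x. cderiv c x \<noteq> 0) \<and> (\<forall>x. bracket (cderiv c x) (cderiv (cderiv c) x) \<noteq> 0) \<and>
       S = range c) \<and>
    S = frontier (convex hull S)"

definition regular_local_param :: "(real^2) set \<Rightarrow> real set \<Rightarrow> (real \<Rightarrow> real^2) \<Rightarrow> bool" where
  "regular_local_param S I g \<longleftrightarrow>
    open I \<and> is_interval I \<and> smooth_curve_on I g \<and> (\<forall>t\<in>I. cderiv g t \<noteq> 0) \<and>
    inj_on g I \<and> openin (top_of_set S) (g ` I)"

text \<open>The co-normal at \<open>g t\<close>, applied to \<open>U\<close>. The function \<open>root 3\<close> is the real cube root, odd on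
  negative arguments, so the value does not depend on the orientation of \<open>g\<close>.\<close>
definition conormal :: "(real \<Rightarrow> real^2) \<Rightarrow> real \<Rightarrow> real^2 \<Rightarrow> real" where
  "conormal g t U = bracket (cderiv g t) U / root 3 (bracket (cderiv g t) (cderiv (cderiv g) t))"

lemma conormal_tangent: "conormal g t (r *\<^sub>R cderiv g t) = 0"
  by (simp add: conormal_def bracket_eq)

lemma conormal_affine_normal:
  assumes "bracket (cderiv g t) (cderiv (cderiv g) t) = 1"
  shows "conormal g t (cderiv (cderiv g) t) = 1"
  using assms by (simp add: conormal_def)

definition chord :: "(real \<Rightarrow> real^2) \<Rightarrow> (real \<Rightarrow> real^2) \<Rightarrow> real \<Rightarrow> real \<Rightarrow> real^2" where
  "chord g1 g2 s t = g2 s - g1 t"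

definition mid_point :: "real \<Rightarrow> (real \<Rightarrow> real^2) \<Rightarrow> (real \<Rightarrow> real^2) \<Rightarrow> real \<Rightarrow> real \<Rightarrow> real^2" where
  "mid_point \<alpha> g1 g2 s t = (1 - \<alpha>) *\<^sub>R g1 t + \<alpha> *\<^sub>R g2 s"

text \<open>The part of \<open>interm_F\<close> (defined next) that is linear in \<open>X\<close>.\<close>
definition interm_lin ::
  "real \<Rightarrow> (real \<Rightarrow> real^2) \<Rightarrow> (real \<Rightarrow> real^2) \<Rightarrow> real \<Rightarrow> real \<Rightarrow> real^2 \<Rightarrow> real" where
  "interm_lin \<alpha> g1 g2 s t U =
     (1 - \<alpha>) * conormal g2 s (chord g1 g2 s t) * conormal g1 t U
     + \<alpha> * conormal g1 t (chord g1 g2 s t) * conormal g2 s U"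

definition interm_F ::
  "real \<Rightarrow> (real \<Rightarrow> real^2) \<Rightarrow> (real \<Rightarrow> real^2) \<Rightarrow> real \<Rightarrow> real \<Rightarrow> real^2 \<Rightarrow> real" where
  "interm_F \<alpha> g1 g2 s t X =
     (1 - \<alpha>) * conormal g2 s (chord g1 g2 s t) * conormal g1 t (X - mid_point \<alpha> g1 g2 s t)
     + \<alpha> * conormal g1 t (chord g1 g2 s t) * conormal g2 s (X - mid_point \<alpha> g1 g2 s t)"

definition envelope_point ::
  "real \<Rightarrow> (real \<Rightarrow> real^2) \<Rightarrow> (real \<Rightarrow> real^2) \<Rightarrow> real \<Rightarrow> real \<Rightarrow> real^2 \<Rightarrow> bool" where
  "envelope_point \<alpha> g1 g2 s t X \<longleftrightarrow>
     interm_F \<alpha> g1 g2 s t X = 0 \<and>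
     ((\<lambda>s'. interm_F \<alpha> g1 g2 s' t X) has_real_derivative 0) (at s) \<and>
     ((\<lambda>t'. interm_F \<alpha> g1 g2 s t' X) has_real_derivative 0) (at t)"

text \<open>The affine equations \<open>F = F\<^sub>s = F\<^sub>t = 0\<close> in \<open>X\<close> have a common solution at infinity, namely the
  direction \<open>U\<close>: the coefficients of \<open>X\<close> in all three of them vanish on \<open>U\<close>. This does happen,
  e.g. for \<open>\<alpha> = 1/2\<close> and two points on an arc of a parabola contained in the oval: the
  intermediate lines are then all parallel to the axis of the parabola. For such a pair the
  condition on the co-normals holds, although no affine point \<open>X\<close> satisfies the equations.\<close>
definition envelope_point_at_infinity ::
  "real \<Rightarrow> (real \<Rightarrow> real^2) \<Rightarrow> (real \<Rightarrow> real^2) \<Rightarrow> real \<Rightarrow> real \<Rightarrow> bool" where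
  "envelope_point_at_infinity \<alpha> g1 g2 s t \<longleftrightarrow>
     (\<exists>U. U \<noteq> 0 \<and> interm_lin \<alpha> g1 g2 s t U = 0 \<and>
       ((\<lambda>s'. interm_lin \<alpha> g1 g2 s' t U) has_real_derivative 0) (at s) \<and>
       ((\<lambda>t'. interm_lin \<alpha> g1 g2 s t' U) has_real_derivative 0) (at t))"

end

theory Submission
  imports Defs
begin

text \<open>Write \<open>a\<close> and \<open>b\<close> for the two co-normals applied to the chord; \<open>F = 0\<close> says that the
  co-normals take the values \<open>\<alpha> a k\<close> and \<open>- (1 - \<alpha>) b k\<close> on \<open>X - M\<close> for some \<open>k\<close>. The derivative
  of the first co-normal is a combination of both co-normals, and on the line \<open>F = 0\<close> its own
  coefficient, the only one involving third derivatives, drops out. What remains of \<open>F\<^sub>s = F\<^sub>t = 0\<close>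
  is \<open>a\<^sup>2 k = - (1 - \<alpha>) b E (k + 1)\<close> and \<open>b\<^sup>2 k = \<alpha> a E (k + 1)\<close> with some \<open>E > 0\<close>.
  Eliminating \<open>k\<close> gives \<open>\<alpha> a\<^sup>3 = - (1 - \<alpha>) b\<^sup>3\<close>. Conversely, this makes the two equations equivalent,
  and they can be solved for \<open>k\<close> unless \<open>b\<^sup>2 = \<alpha> a E\<close>, which is the case of a point at infinity.\<close>

section \<open>Algebra of the planar determinant\<close>

lemma bounded_bilinear_bracket: "bounded_bilinear bracket"
proof -
  have "bounded_bilinear (\<lambda>u v :: real^2. u $ 1 * v $ 2 - u $ 2 * v $ 1)"
    unfolding bilinear_conv_bounded_bilinear[symmetric]
    by (auto simp: bilinear_def linear_iff algebra_simps)
  then show ?thesis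
    by (simp add: bracket_eq[abs_def])
qed

interpretation bracket: bounded_bilinear bracket
  by (rule bounded_bilinear_bracket)

lemma bracket_self [simp]: "bracket u u = 0"
  by (simp add: bracket_eq)

lemma bracket_commute: "bracket u v = - bracket v u"
  by (simp add: bracket_eq)

text \<open>Cramer's rule \<open>w = ([w,v] u + [u,w] v) / [u,v]\<close>, cleared of denominators
  and paired with \<open>x\<close>.\<close>

lemma bracket_plucker:
  "bracket u v * bracket w x = bracket w v * bracket u x + bracket u w * bracket v x"
  by (simp add: bracket_eq algebra_simps)

lemma bracket_eq_0_imp_scaleR:
  assumes "bracket u v = 0" "u \<noteq> 0"
  obtains r where "v = r *\<^sub>R u"
proof -
  have uv: "u $ 1 * v $ 2 = u $ 2 * v $ 1"
    using assms(1) by (simp add: bracket_eq)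
  show thesis
  proof (cases "u $ 1 = 0")
    case True
    with assms(2) have "u $ 2 \<noteq> 0"
      by (auto simp: vec_eq_iff forall_2)
    with True uv show thesis
      by (intro that[of "v $ 2 / u $ 2"]) (auto simp: vec_eq_iff forall_2 field_simps)
  next
    case False
    with uv show thesis
      by (intro that[of "v $ 1 / u $ 1"]) (auto simp: vec_eq_iff forall_2 field_simps)
  qed
qed

lemma bracket_both_eq_0:
  assumes "bracket u v \<noteq> 0" "bracket u x = 0" "bracket v x = 0"
  shows "x = 0"
proof -
  have "bracket u v *\<^sub>R x = bracket x v *\<^sub>R u + bracket u x *\<^sub>R v"
    by (simp add: vec_eq_iff forall_2 bracket_eq algebra_simps)
  with assms show ?thesis
    by (simp add: bracket_commute[of x v])
qed

lemma bracket_solve: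
  assumes "bracket u v \<noteq> 0"
  obtains x where "bracket u x = y" "bracket v x = z"
proof
  let ?x = "(1 / bracket u v) *\<^sub>R (y *\<^sub>R v - z *\<^sub>R u)"
  show "bracket u ?x = y" "bracket v ?x = z"
    using assms bracket_commute[of v u]
    by (simp_all add: bracket.scaleR_right bracket.diff_right)
qed

lemma cderiv_has_vector_derivative:
  "g differentiable (at t) \<Longrightarrow> (g has_vector_derivative cderiv g t) (at t)"
  by (simp add: cderiv_def vector_derivative_works)

lemma smooth_curve_onD:
  assumes "smooth_curve_on I g" "t \<in> I"
  shows "(g has_vector_derivative cderiv g t) (at t)"
    and "(cderiv g has_vector_derivative cderiv (cderiv g) t) (at t)"
    and "cderiv (cderiv g) differentiable (at t)"
proof -
  have *: "((cderiv ^^ n) g) differentiable (at t)" for n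
    using assms by (auto simp: smooth_curve_on_def)
  show "(g has_vector_derivative cderiv g t) (at t)"
    using *[of 0] by (simp add: cderiv_has_vector_derivative)
  show "(cderiv g has_vector_derivative cderiv (cderiv g) t) (at t)"
    using *[of 1] by (simp add: cderiv_has_vector_derivative)
  show "cderiv (cderiv g) differentiable (at t)"
    using *[of 2] by (simp add: numeral_2_eq_2)
qed

subsection \<open>Absence of inflection points\<close>

text \<open>A single l'Hopital step leaves \<open>f' x / (2 * (x - a))\<close>, half a difference
  quotient of \<open>f'\<close> at \<open>a\<close>.\<close>

lemma tendsto_div_square:
  fixes f f' :: "real \<Rightarrow> real"
  assumes f: "\<forall>\<^sub>F x in nhds a. (f has_real_derivative f' x) (at x)"
    and f': "(f' has_real_derivative D) (at a)"
    and "f a = 0" "f' a = 0"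
  shows "((\<lambda>x. f x / (x - a)\<^sup>2) \<longlongrightarrow> D / 2) (at a)"
proof (rule lhopital[where f' = f' and g' = "\<lambda>x. 2 * (x - a)"])
  have "isCont f a"
    using eventually_nhds_x_imp_x[OF f] by (rule DERIV_isCont)
  then show "f \<midarrow>a\<rightarrow> 0"
    using \<open>f a = 0\<close> by (simp add: isCont_def)
  show "(\<lambda>x. (x - a)\<^sup>2) \<midarrow>a\<rightarrow> 0"
    by (rule tendsto_eq_intros refl | simp)+
  show "\<forall>\<^sub>F x in at a. (x - a)\<^sup>2 \<noteq> 0" "\<forall>\<^sub>F x in at a. 2 * (x - a) \<noteq> 0"
    by (auto simp: eventually_at_filter)
  show "\<forall>\<^sub>F x in at a. (f has_real_derivative f' x) (at x)"
    using f by (auto simp: eventually_at_filter elim: eventually_mono)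
  show "\<forall>\<^sub>F x in at a. ((\<lambda>x. (x - a)\<^sup>2) has_real_derivative 2 * (x - a)) (at x)"
    by (intro always_eventually allI) (auto intro!: derivative_eq_intros)
  have "((\<lambda>x. (f' x - f' a) / (x - a) / 2) \<longlongrightarrow> D / 2) (at a)"
    using f' unfolding has_field_derivative_iff by (intro tendsto_divide) auto
  then show "((\<lambda>x. f' x / (2 * (x - a))) \<longlongrightarrow> D / 2) (at a)"
    using \<open>f' a = 0\<close> by (simp add: field_simps)
qed

text \<open>Up to the factor \<open>norm T\<close>, the bracket is the signed distance of
  \<open>g x\<close> from the line through \<open>g a\<close> in direction \<open>T\<close>. The
  velocity at \<open>a\<close> being parallel to \<open>T\<close> removes the first order
  term.\<close>

lemma bracket_curve_tendsto:
  fixes g :: "real \<Rightarrow> real^2"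
  assumes "smooth_curve_on I g" "open I" "a \<in> I" "bracket T (cderiv g a) = 0"
  shows "((\<lambda>x. bracket T (g x - g a) / (x - a)\<^sup>2) \<longlongrightarrow> bracket T (cderiv (cderiv g) a) / 2) (at a)"
proof (rule tendsto_div_square[where f' = "\<lambda>x. bracket T (cderiv g x)"])
  have "((\<lambda>x. bracket T (g x - g a)) has_real_derivative bracket T (cderiv g x)) (at x)"
    if "x \<in> I" for x
  proof -
    have "((\<lambda>x. g x - g a) has_vector_derivative cderiv g x) (at x)"
      using smooth_curve_onD(1)[OF assms(1) that] by (auto intro!: derivative_eq_intros)
    then show ?thesis
      unfolding has_real_derivative_iff_has_vector_derivative
      by (rule bounded_linear.has_vector_derivative[OF bracket.bounded_linear_right])
  qed
  then show "\<forall>\<^sub>F x in nhds a.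
      ((\<lambda>x. bracket T (g x - g a)) has_real_derivative bracket T (cderiv g x)) (at x)"
    using assms(2,3) by (auto simp: eventually_nhds)
  show "((\<lambda>x. bracket T (cderiv g x)) has_real_derivative bracket T (cderiv (cderiv g) a)) (at a)"
    unfolding has_real_derivative_iff_has_vector_derivative
    by (rule bounded_linear.has_vector_derivative[OF bracket.bounded_linear_right])
       (rule smooth_curve_onD(2)[OF assms(1,3)])
qed (use assms in \<open>auto simp: bracket.zero_right\<close>)

lemma curve_norm_tendsto:
  fixes g :: "real \<Rightarrow> 'a::real_normed_vector"
  assumes "(g has_vector_derivative v) (at a)"
  shows "((\<lambda>x. (norm (g x - g a))\<^sup>2 / (x - a)\<^sup>2) \<longlongrightarrow> (norm v)\<^sup>2) (at a)"
proof -
  have "((\<lambda>x. ((g x - g a) - (x - a) *\<^sub>R v) /\<^sub>R \<bar>x - a\<bar>) \<longlongrightarrow> 0) (at a)"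
    using assms by (simp add: has_vector_derivative_def has_derivative_at_within)
  then have "((\<lambda>x. norm (((g x - g a) - (x - a) *\<^sub>R v) /\<^sub>R \<bar>x - a\<bar>)) \<longlongrightarrow> 0) (at a)"
    by (rule tendsto_norm_zero)
  \<comment> \<open>Dividing by \<open>h\<close> instead of its absolute value changes at most the
    sign, which the norm ignores.\<close>
  moreover have "norm ((w - h *\<^sub>R v) /\<^sub>R \<bar>h\<bar>) = norm (w /\<^sub>R h - v)" if "h \<noteq> 0" for w h
  proof -
    have "w /\<^sub>R h - v = (w - h *\<^sub>R v) /\<^sub>R h"
      using that by (simp add: scaleR_diff_right)
    then show ?thesis
      by (simp add: abs_inverse)
  qed
  ultimately have "((\<lambda>x. norm ((g x - g a) /\<^sub>R (x - a) - v)) \<longlongrightarrow> 0) (at a)"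
    by (elim Lim_transform_eventually) (simp add: eventually_at_filter)
  then have "((\<lambda>x. (g x - g a) /\<^sub>R (x - a)) \<longlongrightarrow> v) (at a)"
    using LIM_zero_iff tendsto_norm_zero_iff by blast
  then have "((\<lambda>x. (norm ((g x - g a) /\<^sub>R (x - a)))\<^sup>2) \<longlongrightarrow> (norm v)\<^sup>2) (at a)"
    by (intro tendsto_intros)
  then show ?thesis
    by (simp add: power_mult_distrib power_divide divide_inverse power_inverse mult.commute)
qed

text \<open>The chord length serves as a common parameter: the ratio of the distance from the tangent
  line to the squared chord length has the same limit along \<open>c\<close> and along \<open>g\<close>. So only
  continuity of the change of parameter is needed, not its differentiability.\<close>

lemma oval_no_inflection:
  assumes "smooth_oval S" "regular_local_param S I g" "t \<in> I"
  shows "bracket (cderiv g t) (cderiv (cderiv g) t) \<noteq> 0"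
proof -
  from assms(1) obtain c L where L: "L > 0" and c: "smooth_curve_on UNIV c"
    and per: "\<And>x. c (x + L) = c x" and inj: "inj_on c {0..<L}"
    and reg: "\<And>x. cderiv c x \<noteq> 0"
    and cur: "\<And>x. bracket (cderiv c x) (cderiv (cderiv c) x) \<noteq> 0" and S: "S = range c"
    unfolding smooth_oval_def by blast
  from assms(2) have I: "open I" and g: "smooth_curve_on I g" and greg: "cderiv g t \<noteq> 0"
    and ginj: "inj_on g I" and op: "openin (top_of_set S) (g ` I)"
    using assms(3) by (auto simp: regular_local_param_def)
  have gS: "g x \<in> S" if "x \<in> I" for x
    using openin_imp_subset[OF op] that by auto
  interpret per: periodic_fun_simple c L
    by standard (rule per)
  have reduce: "\<exists>y. a \<le> y \<and> y < a + L \<and> (\<exists>k::int. y = x + of_int k * L)" for x a :: real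
  proof (intro exI conjI)
    let ?k = "- \<lfloor>(x - a) / L\<rfloor>"
    have "of_int \<lfloor>(x - a) / L\<rfloor> \<le> (x - a) / L" "(x - a) / L < of_int \<lfloor>(x - a) / L\<rfloor> + 1"
      by linarith+
    then have "of_int \<lfloor>(x - a) / L\<rfloor> * L \<le> x - a" "x - a < (of_int \<lfloor>(x - a) / L\<rfloor> + 1) * L"
      using L by (simp_all only: pos_le_divide_eq pos_divide_less_eq)
    then show "a \<le> x + of_int ?k * L" "x + of_int ?k * L < a + L"
      by (simp_all add: algebra_simps)
    show "x + of_int ?k * L = x + of_int ?k * L" ..
  qed
  \<comment> \<open>Both parameters are shifted into \<open>{0..<L}\<close>, where \<open>c\<close>
    is injective; so \<open>x - y\<close> is a multiple of \<open>L\<close>, and its size leaves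
    only the multiple 0.\<close>
  have c_eq: "x = y" if eq: "c x = c y" and near: "\<bar>x - y\<bar> < L" for x y
  proof -
    obtain x' k where x': "0 \<le> x'" "x' < 0 + L" "x' = x + of_int k * L"
      using reduce[of 0 x] by blast
    obtain y' l where y': "0 \<le> y'" "y' < 0 + L" "y' = y + of_int l * L"
      using reduce[of 0 y] by blast
    have "c x' = c y'"
      using eq x' y' by (simp add: per.plus_of_int)
    then have "x' = y'"
      using inj_onD[OF inj] x' y' by simp
    then have d: "x - y = of_int (l - k) * L"
      using x' y' by (simp add: algebra_simps)
    then have "\<bar>of_int (l - k)\<bar> * L < 1 * L"
      using near L by (simp add: abs_mult)
    then have "\<bar>of_int (l - k) :: real\<bar> < 1"
      using L by (simp only: mult_less_cancel_right_pos)
    then have "l - k = 0"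
      by linarith
    with d show ?thesis
      by simp
  qed
  obtain x0 where x0: "c x0 = g t"
    using gS[OF assms(3)] S by auto
  \<comment> \<open>The lift \<open>\<phi>\<close> obtained below takes values in the compact window
    of radius \<open>L / 2\<close> around \<open>x0\<close>. All its points are closer than
    \<open>L\<close> to \<open>x0\<close>, so \<open>x0\<close> is the only one mapped to
    \<open>g t\<close>.\<close>
  have "\<exists>y. \<bar>y - x0\<bar> \<le> L / 2 \<and> c y = g x" if x: "x \<in> I" for x
  proof -
    obtain z where z: "c z = g x"
      using gS[OF x] S by auto
    obtain y k where y: "x0 - L / 2 \<le> y" "y < x0 - L / 2 + L" "y = z + of_int k * L"
      using reduce[of "x0 - L / 2" z] by blast
    then have "c y = g x"
      using z by (simp add: per.plus_of_int)
    moreover have "\<bar>y - x0\<bar> \<le> L / 2"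
      using y(1,2) by linarith
    ultimately show ?thesis
      by blast
  qed
  then obtain \<phi> where \<phi>: "\<And>x. x \<in> I \<Longrightarrow> \<bar>\<phi> x - x0\<bar> \<le> L / 2" "\<And>x. x \<in> I \<Longrightarrow> c (\<phi> x) = g x"
    by metis
  have evI: "\<forall>\<^sub>F x in at t. x \<in> I"
    using I assms(3) by (rule eventually_at_in_open')
  have contc: "isCont c x" for x
    using smooth_curve_onD(1)[OF c] has_vector_derivative_continuous by blast
  have contg: "isCont g t"
    using smooth_curve_onD(1)[OF g assms(3)] has_vector_derivative_continuous by blast
  have \<phi>_lim: "(\<phi> \<longlongrightarrow> x0) (at t)"
  proof (rule tendstoI)
    fix e :: real assume e: "e > 0"
    \<comment> \<open>The image of this compact set is closed and misses \<open>g t\<close>. Near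
      \<open>t\<close> the curve \<open>g\<close> avoids it, which forces \<open>\<phi>\<close> into
      the ball.\<close>
    let ?K = "{x0 - L / 2..x0 + L / 2} - ball x0 e"
    have "compact ?K"
      by (intro compact_diff) auto
    then have "closed (c ` ?K)"
      using contc by (intro compact_imp_closed compact_continuous_image)
        (auto simp: continuous_at_imp_continuous_on)
    moreover have "g t \<notin> c ` ?K"
    proof
      assume "g t \<in> c ` ?K"
      then obtain y where y: "y \<in> ?K" "c y = c x0"
        using x0 by auto
      then have "y = x0"
        using L by (intro c_eq) (auto simp: abs_less_iff)
      with y(1) e show False
        by simp
    qed
    ultimately have "\<forall>\<^sub>F x in at t. g x \<in> - c ` ?K"
      using contg by (intro topological_tendstoD[of g "g t"]) (auto simp: isCont_def)
    then show "\<forall>\<^sub>F x in at t. dist (\<phi> x) x0 < e"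
      using evI
    proof eventually_elim
      case (elim x)
      then have "\<phi> x \<notin> ?K"
        using \<phi>(2)[of x] by (metis ComplD imageI)
      moreover have "x0 - L / 2 \<le> \<phi> x" "\<phi> x \<le> x0 + L / 2"
        using \<phi>(1)[OF elim(2)] by linarith+
      ultimately show ?case
        by (auto simp: dist_commute)
    qed
  qed
  have \<phi>_ne: "\<forall>\<^sub>F x in at t. \<phi> x \<noteq> x0"
    using evI eventually_neq_at_within[of t t UNIV]
  proof eventually_elim
    case (elim x)
    then show ?case
      using \<phi>(2)[of x] x0 inj_onD[OF ginj _ _ assms(3), of x] by auto
  qed
  define T where "T = cderiv c x0"
  \<comment> \<open>Half the signed curvature of \<open>c\<close> at \<open>x0\<close>, times
    \<open>norm T\<close>.\<close>
  define \<kappa> where "\<kappa> = bracket T (cderiv (cderiv c) x0) / 2 / (norm T)\<^sup>2"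
  have \<kappa>: "\<kappa> \<noteq> 0" and T: "T \<noteq> 0"
    using cur reg by (auto simp: \<kappa>_def T_def)
  have "((\<lambda>x. (bracket T (c x - c x0) / (x - x0)\<^sup>2) / ((norm (c x - c x0))\<^sup>2 / (x - x0)\<^sup>2))
      \<longlongrightarrow> \<kappa>) (at x0)"
    unfolding \<kappa>_def
    by (intro tendsto_divide bracket_curve_tendsto[OF c] curve_norm_tendsto)
       (use T smooth_curve_onD(1)[OF c] in \<open>auto simp: T_def\<close>)
  then have "((\<lambda>x. bracket T (c x - c x0) / (norm (c x - c x0))\<^sup>2) \<longlongrightarrow> \<kappa>) (at x0)"
    by (rule Lim_transform_eventually) (auto simp: eventually_at_filter)
  moreover have "filterlim \<phi> (at x0) (at t)"
    using \<phi>_lim \<phi>_ne by (simp add: filterlim_at)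
  ultimately have "((\<lambda>x. bracket T (c (\<phi> x) - c x0) / (norm (c (\<phi> x) - c x0))\<^sup>2) \<longlongrightarrow> \<kappa>) (at t)"
    by (rule filterlim_compose)
  moreover have "\<forall>\<^sub>F x in at t. bracket T (c (\<phi> x) - c x0) / (norm (c (\<phi> x) - c x0))\<^sup>2
      = bracket T (g x - g t) / (norm (g x - g t))\<^sup>2"
    using evI by eventually_elim (simp add: \<phi>(2) x0)
  ultimately have "((\<lambda>x. bracket T (g x - g t) / (norm (g x - g t))\<^sup>2) \<longlongrightarrow> \<kappa>) (at t)"
    by (rule Lim_transform_eventually)
  then have "((\<lambda>x. bracket T (g x - g t) / (norm (g x - g t))\<^sup>2 * ((norm (g x - g t))\<^sup>2 / (x - t)\<^sup>2))
      \<longlongrightarrow> \<kappa> * (norm (cderiv g t))\<^sup>2) (at t)"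
    by (intro tendsto_mult curve_norm_tendsto smooth_curve_onD(1)[OF g assms(3)])
  \<comment> \<open>Where \<open>g x = g t\<close>, the left side is 0 by division by zero, and the
    bracket on the right vanishes too.\<close>
  moreover have "\<forall>\<^sub>F x in at t. bracket T (g x - g t) / (norm (g x - g t))\<^sup>2 *
      ((norm (g x - g t))\<^sup>2 / (x - t)\<^sup>2) = bracket T (g x - g t) / (x - t)\<^sup>2"
    by (intro always_eventually allI) (auto simp: bracket.zero_right)
  ultimately have lim:
    "((\<lambda>x. bracket T (g x - g t) / (x - t)\<^sup>2) \<longlongrightarrow> \<kappa> * (norm (cderiv g t))\<^sup>2) (at t)"
    by (rule Lim_transform_eventually)
  \<comment> \<open>Along \<open>g\<close> the distance to the tangent line of \<open>c\<close> is
    quadratically small, so \<open>bracket T (g x)\<close> has derivative 0 at \<open>t\<close>: the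
    two curves share their tangent direction.\<close>
  have "((\<lambda>x. bracket T (g x - g t) / (x - t)\<^sup>2 * (x - t)) \<longlongrightarrow> \<kappa> * (norm (cderiv g t))\<^sup>2 * 0) (at t)"
    by (intro tendsto_mult lim) (rule tendsto_eq_intros refl | simp)+
  moreover have "\<forall>\<^sub>F x in at t. bracket T (g x - g t) / (x - t)\<^sup>2 * (x - t)
      = (bracket T (g x) - bracket T (g t)) / (x - t)"
    by (auto simp: eventually_at_filter bracket.diff_right power2_eq_square)
  ultimately have "((\<lambda>x. (bracket T (g x) - bracket T (g t)) / (x - t)) \<longlongrightarrow> 0) (at t)"
    using Lim_transform_eventually by force
  then have "((\<lambda>x. bracket T (g x)) has_real_derivative 0) (at t)"
    by (simp add: has_field_derivative_iff)
  moreover have "((\<lambda>x. bracket T (g x)) has_real_derivative bracket T (cderiv g t)) (at t)"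
    unfolding has_real_derivative_iff_has_vector_derivative
    by (rule bounded_linear.has_vector_derivative[OF bracket.bounded_linear_right])
       (rule smooth_curve_onD(1)[OF g assms(3)])
  ultimately have tangent: "bracket T (cderiv g t) = 0"
    using DERIV_unique by blast
  then obtain r where r: "cderiv g t = r *\<^sub>R T"
    using T by (rule bracket_eq_0_imp_scaleR)
  \<comment> \<open>With tangency known, the second order expansion of \<open>g\<close> evaluates
    the same limit.\<close>
  have "bracket T (cderiv (cderiv g) t) / 2 = \<kappa> * (norm (cderiv g t))\<^sup>2"
    using bracket_curve_tendsto[OF g I assms(3) tangent] lim by (intro LIM_unique)
  with \<kappa> greg have "bracket T (cderiv (cderiv g) t) \<noteq> 0"
    by auto
  with r greg show ?thesis
    by (auto simp: bracket.scaleR_left)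
qed


subsection \<open>Derivatives of the intermediate line functional\<close>

text \<open>\<open>\<rho>\<close> is fixed before \<open>V\<close>: third derivatives enter through
  it alone, and its being the same for every \<open>V\<close> lets it cancel later.\<close>

lemma conormal_has_real_derivative:
  assumes "(cderiv g has_vector_derivative cderiv (cderiv g) t) (at t)"
    and "cderiv (cderiv g) differentiable (at t)"
    and "bracket (cderiv g t) (cderiv (cderiv g) t) \<noteq> 0"
  obtains \<rho> where "\<And>V V'. (V has_vector_derivative V') (at t) \<Longrightarrow>
    ((\<lambda>x. conormal g x (V x)) has_real_derivative \<rho> * conormal g t (V t)
      + bracket (cderiv (cderiv g) t) (V t) / root 3 (bracket (cderiv g t) (cderiv (cderiv g) t))
      + conormal g t V') (at t)"
proof -
  define r where "r x = root 3 (bracket (cderiv g x) (cderiv (cderiv g) x))" for x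
  have rt: "r t \<noteq> 0"
    using assms(3) by (simp add: r_def)
  have "\<exists>K. ((\<lambda>x. bracket (cderiv g x) (cderiv (cderiv g) x)) has_real_derivative K) (at t)"
    unfolding has_real_derivative_iff_has_vector_derivative
    using bracket.has_vector_derivative[OF assms(1)] assms(2)
    by (auto simp: vector_derivative_works)
  then obtain K where
    K: "((\<lambda>x. bracket (cderiv g x) (cderiv (cderiv g) x)) has_real_derivative K) (at t)" ..
  have "\<exists>R. (r has_real_derivative R) (at t)"
    unfolding r_def[abs_def]
    using DERIV_chain2[OF DERIV_odd_real_root[OF _ assms(3)] K, of 3] by auto
  then obtain R where R: "(r has_real_derivative R) (at t)" ..
  show thesis
  proof (rule that[of "- R / r t"])
    fix V :: "real \<Rightarrow> real^2" and V' assume V: "(V has_vector_derivative V') (at t)"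
    have "((\<lambda>x. bracket (cderiv g x) (V x)) has_real_derivative
        bracket (cderiv g t) V' + bracket (cderiv (cderiv g) t) (V t)) (at t)"
      unfolding has_real_derivative_iff_has_vector_derivative
      by (rule bracket.has_vector_derivative[OF assms(1) V])
    from DERIV_divide[OF this R rt]
    show "((\<lambda>x. conormal g x (V x)) has_real_derivative - R / r t * conormal g t (V t)
      + bracket (cderiv (cderiv g) t) (V t) / root 3 (bracket (cderiv g t) (cderiv (cderiv g) t))
      + conormal g t V') (at t)"
      unfolding conormal_def r_def[symmetric]
      by (rule DERIV_cong) (use rt in \<open>simp add: field_simps\<close>)
  qed
qed

lemma conormal_minus: "conormal g t (- u) = - conormal g t u"
  and conormal_scaleR: "conormal g t (r *\<^sub>R u) = r * conormal g t u"
  by (simp_all add: conormal_def bracket.minus_right bracket.scaleR_right)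

lemma conormal_compose_has_real_derivative:
  assumes "(V has_vector_derivative V') (at t)"
  shows "((\<lambda>x. conormal g s (V x)) has_real_derivative conormal g s V') (at t)"
proof -
  have "((\<lambda>x. bracket (cderiv g s) (V x)) has_real_derivative bracket (cderiv g s) V') (at t)"
    unfolding has_real_derivative_iff_has_vector_derivative
    by (rule bounded_linear.has_vector_derivative[OF bracket.bounded_linear_right assms])
  then show ?thesis
    unfolding conormal_def by (rule DERIV_cdivide)
qed

text \<open>Cramer's rule expands the second derivative of \<open>g1\<close> in the two tangents.
  The coefficient of its own tangent joins \<open>\<rho>\<close> in \<open>p\<close>; the other one
  gives \<open>q\<close>, free of third derivatives.\<close>

lemma conormal_deriv_pair:
  assumes "(cderiv g1 has_vector_derivative cderiv (cderiv g1) t) (at t)"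
    and "cderiv (cderiv g1) differentiable (at t)"
    and "bracket (cderiv g1 t) (cderiv (cderiv g1) t) \<noteq> 0"
    and "bracket (cderiv g2 s) (cderiv (cderiv g2) s) \<noteq> 0"
    and "bracket (cderiv g1 t) (cderiv g2 s) \<noteq> 0"
  obtains p q where "\<And>V V'. (V has_vector_derivative V') (at t) \<Longrightarrow>
    ((\<lambda>x. conormal g1 x (V x)) has_real_derivative
      p * conormal g1 t (V t) + q * conormal g2 s (V t) + conormal g1 t V') (at t)"
    and "q * bracket (cderiv g1 t) (cderiv g2 s) =
      (root 3 (bracket (cderiv g1 t) (cderiv (cderiv g1) t)))\<^sup>2 *
      root 3 (bracket (cderiv g2 s) (cderiv (cderiv g2) s))"
proof -
  define D where "D = bracket (cderiv g1 t) (cderiv g2 s)"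
  define r1 where "r1 = root 3 (bracket (cderiv g1 t) (cderiv (cderiv g1) t))"
  define r2 where "r2 = root 3 (bracket (cderiv g2 s) (cderiv (cderiv g2) s))"
  have nz: "D \<noteq> 0" "r1 \<noteq> 0" "r2 \<noteq> 0"
    using assms(3-5) by (auto simp: D_def r1_def r2_def)
  have r1: "bracket (cderiv g1 t) (cderiv (cderiv g1) t) = r1 ^ 3"
    unfolding r1_def by (simp add: odd_real_root_pow)
  obtain \<rho> where \<rho>: "\<And>V V'. (V has_vector_derivative V') (at t) \<Longrightarrow>
    ((\<lambda>x. conormal g1 x (V x)) has_real_derivative \<rho> * conormal g1 t (V t)
      + bracket (cderiv (cderiv g1) t) (V t) / r1 + conormal g1 t V') (at t)"
    unfolding r1_def by (rule conormal_has_real_derivative[OF assms(1-3)]) blast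
  let ?b = "bracket (cderiv (cderiv g1) t) (cderiv g2 s)"
  have *: "bracket (cderiv (cderiv g1) t) U / r1
      = ?b / D * conormal g1 t U + r1\<^sup>2 * r2 / D * conormal g2 s U" for U
  proof -
    have "D * bracket (cderiv (cderiv g1) t) U
        = ?b * bracket (cderiv g1 t) U + r1 ^ 3 * bracket (cderiv g2 s) U"
      unfolding r1[symmetric] D_def by (rule bracket_plucker)
    then show ?thesis
      using nz unfolding conormal_def r1_def[symmetric] r2_def[symmetric]
      by (simp add: field_simps power2_eq_square power3_eq_cube)
  qed
  show thesis
  proof (rule that[of "\<rho> + ?b / D" "r1\<^sup>2 * r2 / D"])
    fix V :: "real \<Rightarrow> real^2" and V' assume V: "(V has_vector_derivative V') (at t)"
    show "((\<lambda>x. conormal g1 x (V x)) has_real_derivative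
      (\<rho> + ?b / D) * conormal g1 t (V t) + r1\<^sup>2 * r2 / D * conormal g2 s (V t)
      + conormal g1 t V') (at t)"
      by (rule DERIV_cong[OF \<rho>[OF V]]) (simp add: * algebra_simps)
  next
    show "r1\<^sup>2 * r2 / D * bracket (cderiv g1 t) (cderiv g2 s) =
      (root 3 (bracket (cderiv g1 t) (cderiv (cderiv g1) t)))\<^sup>2 *
      root 3 (bracket (cderiv g2 s) (cderiv (cderiv g2) s))"
      using nz by (simp add: D_def r1_def r2_def)
  qed
qed

text \<open>The \<open>E\<close> of the overview: the square of the determinant of the two
  co-normals as covectors. Squaring makes it symmetric in the two points.\<close>

definition pair_weight :: "(real \<Rightarrow> real^2) \<Rightarrow> (real \<Rightarrow> real^2) \<Rightarrow> real \<Rightarrow> real \<Rightarrow> real" where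
  "pair_weight g1 g2 s t = (bracket (cderiv g1 t) (cderiv g2 s) /
     (root 3 (bracket (cderiv g1 t) (cderiv (cderiv g1) t)) *
      root 3 (bracket (cderiv g2 s) (cderiv (cderiv g2) s))))\<^sup>2"

text \<open>\<open>Y1\<close> and \<open>Y2\<close> place the argument at position \<open>k\<close>
  on the line where the functional vanishes. There \<open>p\<close> only multiplies the functional
  itself and drops out.\<close>

lemma interm_lin_deriv_t_eq_0_iff:
  fixes g1 g2 :: "real \<Rightarrow> real^2"
  assumes g1: "(g1 has_vector_derivative cderiv g1 t) (at t)"
    and g1': "(cderiv g1 has_vector_derivative cderiv (cderiv g1) t) (at t)"
    and g1'': "cderiv (cderiv g1) differentiable (at t)"
    and c1: "bracket (cderiv g1 t) (cderiv (cderiv g1) t) \<noteq> 0"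
    and c2: "bracket (cderiv g2 s) (cderiv (cderiv g2) s) \<noteq> 0"
    and D: "bracket (cderiv g1 t) (cderiv g2 s) \<noteq> 0"
    and \<alpha>: "\<alpha> \<noteq> 1"
    and Y1: "conormal g1 t (X - \<epsilon> *\<^sub>R mid_point \<alpha> g1 g2 s t)
      = \<alpha> * conormal g1 t (chord g1 g2 s t) * k"
    and Y2: "conormal g2 s (X - \<epsilon> *\<^sub>R mid_point \<alpha> g1 g2 s t)
      = - (1 - \<alpha>) * conormal g2 s (chord g1 g2 s t) * k"
  shows "((\<lambda>x. interm_lin \<alpha> g1 g2 s x (X - \<epsilon> *\<^sub>R mid_point \<alpha> g1 g2 s x)) has_real_derivative 0) (at t)
    \<longleftrightarrow> (conormal g2 s (chord g1 g2 s t))\<^sup>2 * k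
      = \<alpha> * conormal g1 t (chord g1 g2 s t) * pair_weight g1 g2 s t * (k + \<epsilon>)"
proof -
  let ?Y = "\<lambda>x. X - \<epsilon> *\<^sub>R mid_point \<alpha> g1 g2 s x"
  define a where "a = conormal g1 t (chord g1 g2 s t)"
  define b where "b = conormal g2 s (chord g1 g2 s t)"
  define n where "n = conormal g2 s (cderiv g1 t)"
  define D where "D = bracket (cderiv g1 t) (cderiv g2 s)"
  define r1 where "r1 = root 3 (bracket (cderiv g1 t) (cderiv (cderiv g1) t))"
  define r2 where "r2 = root 3 (bracket (cderiv g2 s) (cderiv (cderiv g2) s))"
  have nz: "D \<noteq> 0" "r1 \<noteq> 0" "r2 \<noteq> 0"
    using c1 c2 D by (auto simp: D_def r1_def r2_def)
  have n: "n = - D / r2"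
    using bracket_commute[of "cderiv g1 t" "cderiv g2 s"]
    by (auto simp: n_def conormal_def D_def r2_def)
  obtain p q where pq: "\<And>V V'. (V has_vector_derivative V') (at t) \<Longrightarrow>
    ((\<lambda>x. conormal g1 x (V x)) has_real_derivative
      p * conormal g1 t (V t) + q * conormal g2 s (V t) + conormal g1 t V') (at t)"
    and "q * D = r1\<^sup>2 * r2"
    unfolding D_def r1_def r2_def
    by (rule conormal_deriv_pair[OF g1' g1'' c1 c2 assms(6)]) blast
  then have q: "q = r1\<^sup>2 * r2 / D"
    using nz by (simp add: field_simps)
  have tang: "conormal g1 t (cderiv g1 t) = 0"
    by (simp add: conormal_def)
  have dC: "(chord g1 g2 s has_vector_derivative - cderiv g1 t) (at t)"
    unfolding chord_def[abs_def] using g1 by (auto intro!: derivative_eq_intros)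
  have dY: "(?Y has_vector_derivative (- \<epsilon> * (1 - \<alpha>)) *\<^sub>R cderiv g1 t) (at t)"
    unfolding mid_point_def using g1 by (auto intro!: derivative_eq_intros)
  \<comment> \<open>Chord and intermediate point move along the tangent of \<open>g1\<close>, which
    the first co-normal kills, so their motion contributes only through \<open>n\<close>. The
    weights \<open>(1 - \<alpha>)\<^sup>2\<close> and \<open>\<alpha> * (1 - \<alpha>)\<close> of
    the \<open>q\<close> terms add up to \<open>1 - \<alpha>\<close>.\<close>
  have d: "((\<lambda>x. interm_lin \<alpha> g1 g2 s x (?Y x)) has_real_derivative
      - (1 - \<alpha>) * (q * b\<^sup>2 * k + \<alpha> * a * n * (k + \<epsilon>))) (at t)"
    unfolding interm_lin_def
    apply (rule DERIV_cong)
     apply (rule DERIV_add DERIV_mult DERIV_const pq[OF dC] pq[OF dY]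
        conormal_compose_has_real_derivative[OF dC] conormal_compose_has_real_derivative[OF dY])+
    unfolding Y1 Y2 conormal_scaleR conormal_minus tang
    unfolding a_def[symmetric] b_def[symmetric] n_def[symmetric]
    apply (simp add: algebra_simps power2_eq_square)
    done
  have "((\<lambda>x. interm_lin \<alpha> g1 g2 s x (?Y x)) has_real_derivative 0) (at t)
      \<longleftrightarrow> q * b\<^sup>2 * k + \<alpha> * a * n * (k + \<epsilon>) = 0"
  proof
    assume "((\<lambda>x. interm_lin \<alpha> g1 g2 s x (?Y x)) has_real_derivative 0) (at t)"
    from DERIV_unique[OF d this] show "q * b\<^sup>2 * k + \<alpha> * a * n * (k + \<epsilon>) = 0"
      using \<alpha> by (simp only: mult_eq_0_iff neg_equal_0_iff_equal) simp
  next
    assume "q * b\<^sup>2 * k + \<alpha> * a * n * (k + \<epsilon>) = 0"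
    with d show "((\<lambda>x. interm_lin \<alpha> g1 g2 s x (?Y x)) has_real_derivative 0) (at t)"
      by simp
  qed
  also have "\<dots> \<longleftrightarrow> b\<^sup>2 * k = \<alpha> * a * (D / (r1 * r2))\<^sup>2 * (k + \<epsilon>)"
  proof -
    \<comment> \<open>The factor is \<open>1 / q\<close>, and \<open>n / q\<close> is minus the pair
      weight.\<close>
    have "b\<^sup>2 * k - \<alpha> * a * (D / (r1 * r2))\<^sup>2 * (k + \<epsilon>)
        = D / (r1\<^sup>2 * r2) * (q * b\<^sup>2 * k + \<alpha> * a * n * (k + \<epsilon>))"
      using nz unfolding q n by (simp add: field_simps power2_eq_square)
    then show ?thesis
      using nz by auto
  qed
  finally show ?thesis
    by (simp add: a_def b_def D_def r1_def r2_def pair_weight_def)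
qed

section \<open>Exchanging the two points\<close>

lemma chord_swap: "chord g2 g1 t s = - chord g1 g2 s t"
  by (simp add: chord_def)

lemma mid_point_swap: "mid_point (1 - \<alpha>) g2 g1 t s = mid_point \<alpha> g1 g2 s t"
  by (simp add: mid_point_def)

text \<open>The two summands trade places, and the reversed chord changes the sign. This reduces the
  derivative in \<open>s\<close> to the one in \<open>t\<close>.\<close>

lemma interm_lin_swap: "interm_lin (1 - \<alpha>) g2 g1 t s U = - interm_lin \<alpha> g1 g2 s t U"
  by (simp add: interm_lin_def chord_swap[of g2 g1] conormal_minus)

lemma pair_weight_swap: "pair_weight g2 g1 t s = pair_weight g1 g2 s t"
  by (simp add: pair_weight_def mult.commute power_divide bracket_commute[of "cderiv g2 s" "cderiv g1 t"])

lemma interm_F_eq: "interm_F \<alpha> g1 g2 s t X = interm_lin \<alpha> g1 g2 s t (X - mid_point \<alpha> g1 g2 s t)"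
  by (simp add: interm_F_def interm_lin_def)

subsection \<open>The envelope system\<close>

text \<open>The parameter \<open>\<epsilon>\<close> is a homogeneous coordinate: \<open>\<epsilon> = 1\<close> gives the equations of an envelope
  point \<open>X\<close>, and \<open>\<epsilon> = 0\<close> those of a point at infinity in direction \<open>X\<close>.\<close>
definition envelope_system ::
  "real \<Rightarrow> real \<Rightarrow> (real \<Rightarrow> real^2) \<Rightarrow> (real \<Rightarrow> real^2) \<Rightarrow> real \<Rightarrow> real \<Rightarrow> real^2 \<Rightarrow> bool" where
  "envelope_system \<epsilon> \<alpha> g1 g2 s t X \<longleftrightarrow>
     interm_lin \<alpha> g1 g2 s t (X - \<epsilon> *\<^sub>R mid_point \<alpha> g1 g2 s t) = 0 \<and>
     ((\<lambda>s'. interm_lin \<alpha> g1 g2 s' t (X - \<epsilon> *\<^sub>R mid_point \<alpha> g1 g2 s' t)) has_real_derivative 0) (at s) \<and>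
     ((\<lambda>t'. interm_lin \<alpha> g1 g2 s t' (X - \<epsilon> *\<^sub>R mid_point \<alpha> g1 g2 s t')) has_real_derivative 0) (at t)"

lemma envelope_point_eq: "envelope_point \<alpha> g1 g2 s t X = envelope_system 1 \<alpha> g1 g2 s t X"
  by (simp add: envelope_point_def envelope_system_def interm_F_eq)

lemma envelope_point_at_infinity_eq:
  "envelope_point_at_infinity \<alpha> g1 g2 s t \<longleftrightarrow> (\<exists>U. U \<noteq> 0 \<and> envelope_system 0 \<alpha> g1 g2 s t U)"
  by (simp add: envelope_point_at_infinity_def envelope_system_def)

section \<open>Algebra for a fixed pair, in co-normal coordinates\<close>

locale nonparallel_pair =
  fixes g1 g2 :: "real \<Rightarrow> real^2" and s t :: real
  assumes g1: "(g1 has_vector_derivative cderiv g1 t) (at t)"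
    "(cderiv g1 has_vector_derivative cderiv (cderiv g1) t) (at t)"
    "cderiv (cderiv g1) differentiable (at t)"
    and g2: "(g2 has_vector_derivative cderiv g2 s) (at s)"
    "(cderiv g2 has_vector_derivative cderiv (cderiv g2) s) (at s)"
    "cderiv (cderiv g2) differentiable (at s)"
    and curv1: "bracket (cderiv g1 t) (cderiv (cderiv g1) t) \<noteq> 0"
    and curv2: "bracket (cderiv g2 s) (cderiv (cderiv g2) s) \<noteq> 0"
    and nonparallel: "bracket (cderiv g1 t) (cderiv g2 s) \<noteq> 0"
    and distinct: "g1 t \<noteq> g2 s"
begin

abbreviation "a \<equiv> conormal g1 t (chord g1 g2 s t)"
abbreviation "b \<equiv> conormal g2 s (chord g1 g2 s t)"
abbreviation "E \<equiv> pair_weight g1 g2 s t"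

lemma E_pos: "E > 0"
  using curv1 curv2 nonparallel
  by (simp add: pair_weight_def)

text \<open>Nonparallel tangents make the co-normals coordinates on the plane; this is injectivity,
  and \<open>conormal_solve\<close> is surjectivity.\<close>

lemma conormal_both_eq_0:
  assumes "conormal g1 t U = 0" "conormal g2 s U = 0"
  shows "U = 0"
  using assms curv1 curv2 by (intro bracket_both_eq_0[OF nonparallel]) (auto simp: conormal_def)

lemma conormal_solve:
  obtains U where "conormal g1 t U = y" "conormal g2 s U = z"
proof -
  obtain U where
    "bracket (cderiv g1 t) U = y * root 3 (bracket (cderiv g1 t) (cderiv (cderiv g1) t))"
    "bracket (cderiv g2 s) U = z * root 3 (bracket (cderiv g2 s) (cderiv (cderiv g2) s))"
    using bracket_solve[OF nonparallel] by blast
  then show thesis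
    using curv1 curv2 by (intro that[of U]) (simp_all add: conormal_def)
qed

lemma a_or_b_nonzero: "a \<noteq> 0 \<or> b \<noteq> 0"
  using conormal_both_eq_0[of "chord g1 g2 s t"] distinct by (auto simp: chord_def)

lemma envelope_system_iff:
  assumes "\<alpha> \<noteq> 0" "\<alpha> \<noteq> 1"
    and Y: "conormal g1 t (X - \<epsilon> *\<^sub>R mid_point \<alpha> g1 g2 s t) = \<alpha> * a * k"
      "conormal g2 s (X - \<epsilon> *\<^sub>R mid_point \<alpha> g1 g2 s t) = - (1 - \<alpha>) * b * k"
  shows "envelope_system \<epsilon> \<alpha> g1 g2 s t X \<longleftrightarrow>
    a\<^sup>2 * k = - (1 - \<alpha>) * b * E * (k + \<epsilon>) \<and> b\<^sup>2 * k = \<alpha> * a * E * (k + \<epsilon>)"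
proof -
  \<comment> \<open>The criterion for \<open>t\<close>, applied to the exchanged pair: because the
    chord is reversed, the same \<open>k\<close> fits.\<close>
  have "((\<lambda>s'. interm_lin (1 - \<alpha>) g2 g1 t s' (X - \<epsilon> *\<^sub>R mid_point (1 - \<alpha>) g2 g1 t s'))
      has_real_derivative 0) (at s) \<longleftrightarrow>
      (conormal g1 t (chord g2 g1 t s))\<^sup>2 * k
      = (1 - \<alpha>) * conormal g2 s (chord g2 g1 t s) * pair_weight g2 g1 t s * (k + \<epsilon>)"
    using assms nonparallel bracket_commute[of "cderiv g2 s" "cderiv g1 t"]
    by (intro interm_lin_deriv_t_eq_0_iff g2 curv1 curv2)
      (simp_all add: mid_point_swap chord_swap[of g2 g1] conormal_minus algebra_simps)
  moreover have "((\<lambda>s'. - f s') has_real_derivative 0) (at s)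
      \<longleftrightarrow> (f has_real_derivative 0) (at s)" for f :: "real \<Rightarrow> real"
    using DERIV_minus[of f 0 s UNIV] DERIV_minus[of "\<lambda>x. - f x" 0 s UNIV] by auto
  ultimately have "((\<lambda>s'. interm_lin \<alpha> g1 g2 s' t (X - \<epsilon> *\<^sub>R mid_point \<alpha> g1 g2 s' t))
      has_real_derivative 0) (at s) \<longleftrightarrow> a\<^sup>2 * k = - (1 - \<alpha>) * b * E * (k + \<epsilon>)"
    by (simp add: mid_point_swap interm_lin_swap chord_swap[of g2 g1] conormal_minus
        pair_weight_swap[of g2 g1] algebra_simps)
  moreover have "interm_lin \<alpha> g1 g2 s t (X - \<epsilon> *\<^sub>R mid_point \<alpha> g1 g2 s t) = 0"
    unfolding interm_lin_def Y by (simp add: algebra_simps)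
  ultimately show ?thesis
    unfolding envelope_system_def
    using interm_lin_deriv_t_eq_0_iff[OF g1 curv1 curv2 nonparallel \<open>\<alpha> \<noteq> 1\<close> Y] by simp
qed

text \<open>In co-normal coordinates the equation is the line spanned by
  \<open>(\<alpha> * a, - (1 - \<alpha>) * b)\<close>; \<open>k\<close> is read off at a nonzero
  entry.\<close>

lemma interm_lin_eq_0_param:
  assumes "interm_lin \<alpha> g1 g2 s t Y = 0" "\<alpha> \<noteq> 0" "\<alpha> \<noteq> 1"
  obtains k where "conormal g1 t Y = \<alpha> * a * k" "conormal g2 s Y = - (1 - \<alpha>) * b * k"
proof (cases "a = 0")
  case True
  with assms a_or_b_nonzero show thesis
    by (intro that[of "- conormal g2 s Y / ((1 - \<alpha>) * b)"]) (auto simp: interm_lin_def field_simps)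
next
  case False
  with assms show thesis
    by (intro that[of "conormal g1 t Y / (\<alpha> * a)"]) (auto simp: interm_lin_def field_simps)
qed

lemma envelope_point_imp_cubes:
  assumes "envelope_point \<alpha> g1 g2 s t X" "\<alpha> \<noteq> 0" "\<alpha> \<noteq> 1"
  shows "\<alpha> * a ^ 3 = - (1 - \<alpha>) * b ^ 3"
proof -
  have sys: "envelope_system 1 \<alpha> g1 g2 s t X"
    using assms(1) by (simp add: envelope_point_eq)
  then have "interm_lin \<alpha> g1 g2 s t (X - 1 *\<^sub>R mid_point \<alpha> g1 g2 s t) = 0"
    unfolding envelope_system_def by blast
  then obtain k where
    k: "conormal g1 t (X - 1 *\<^sub>R mid_point \<alpha> g1 g2 s t) = \<alpha> * a * k"
      "conormal g2 s (X - 1 *\<^sub>R mid_point \<alpha> g1 g2 s t) = - (1 - \<alpha>) * b * k"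
    using assms(2,3) by (rule interm_lin_eq_0_param)
  have eqs: "a\<^sup>2 * k = - (1 - \<alpha>) * b * E * (k + 1)" "b\<^sup>2 * k = \<alpha> * a * E * (k + 1)"
    using sys envelope_system_iff[OF assms(2,3) k] by auto
  \<comment> \<open>Either exception makes one side of both equations vanish, forcing
    \<open>a = b = 0\<close>.\<close>
  have "k \<noteq> 0" "k + 1 \<noteq> 0"
    using eqs a_or_b_nonzero E_pos assms(2,3) by auto
  \<comment> \<open>Cross-multiplying the two equations produces the common factor
    \<open>E * k * (k + 1)\<close>.\<close>
  have "(\<alpha> * a * E * (k + 1)) * (a\<^sup>2 * k) = (- (1 - \<alpha>) * b * E * (k + 1)) * (b\<^sup>2 * k)"
    unfolding eqs by simp
  then have "(\<alpha> * a ^ 3) * (E * k * (k + 1)) = (- (1 - \<alpha>) * b ^ 3) * (E * k * (k + 1))"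
    by (simp add: power2_eq_square power3_eq_cube mult_ac)
  then show ?thesis
    using \<open>k \<noteq> 0\<close> \<open>k + 1 \<noteq> 0\<close> E_pos by simp
qed

lemma cubes_imp_envelope_point:
  assumes cubes: "\<alpha> * a ^ 3 = - (1 - \<alpha>) * b ^ 3" and "\<alpha> \<noteq> 0" "\<alpha> \<noteq> 1"
    and ninf: "\<not> envelope_point_at_infinity \<alpha> g1 g2 s t"
  obtains X where "envelope_point \<alpha> g1 g2 s t X"
proof -
  have nz: "a \<noteq> 0" "b \<noteq> 0"
    using assms(1-3) a_or_b_nonzero by auto
  \<comment> \<open>Here \<open>l\<close> stands for \<open>k + \<epsilon>\<close>, to serve affine
    points and points at infinity alike. After multiplication by \<open>b\<^sup>2\<close> the cube
    relation turns the second equation into the first.\<close>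
  have first: "a\<^sup>2 * k = - (1 - \<alpha>) * b * E * l" if "b\<^sup>2 * k = \<alpha> * a * E * l" for k l
  proof -
    have "b\<^sup>2 * (a\<^sup>2 * k) = a\<^sup>2 * (\<alpha> * a * E * l)"
      using that by simp
    also have "\<dots> = (\<alpha> * a ^ 3) * (E * l)"
      by (simp add: power2_eq_square power3_eq_cube mult_ac)
    also have "\<dots> = b\<^sup>2 * (- (1 - \<alpha>) * b * E * l)"
      unfolding cubes by (simp add: power2_eq_square power3_eq_cube mult_ac)
    finally show ?thesis
      using nz by simp
  qed
  \<comment> \<open>Equality would solve the system with \<open>\<epsilon> = 0\<close> and
    \<open>k = 1\<close>, so the direction of the intermediate line would be a solution at
    infinity.\<close>
  have ne: "b\<^sup>2 \<noteq> \<alpha> * a * E"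
  proof
    assume eq: "b\<^sup>2 = \<alpha> * a * E"
    obtain U where U: "conormal g1 t U = \<alpha> * a * 1" "conormal g2 s U = - (1 - \<alpha>) * b * 1"
      by (rule conormal_solve)
    have "envelope_system 0 \<alpha> g1 g2 s t U"
      using envelope_system_iff[of \<alpha> U 0 1] U eq first[of 1 1] assms(2,3) by simp
    moreover have "U \<noteq> 0"
      using U nz assms(2) by (auto simp: conormal_def bracket.zero_right)
    ultimately show False
      using ninf by (auto simp: envelope_point_at_infinity_eq)
  qed
  define k where "k = \<alpha> * a * E / (b\<^sup>2 - \<alpha> * a * E)"
  have k: "b\<^sup>2 * k = \<alpha> * a * E * (k + 1)"
    using ne by (simp add: k_def field_simps)
  obtain Y where Y: "conormal g1 t Y = \<alpha> * a * k" "conormal g2 s Y = - (1 - \<alpha>) * b * k"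
    by (rule conormal_solve)
  have "envelope_system 1 \<alpha> g1 g2 s t (Y + mid_point \<alpha> g1 g2 s t)"
    using envelope_system_iff[of \<alpha> "Y + mid_point \<alpha> g1 g2 s t" 1 k] Y k first assms(2,3) by simp
  then show thesis
    by (intro that) (simp add: envelope_point_eq)
qed

lemma cubes_iff:
  assumes "0 < \<alpha>" "\<alpha> < 1"
  shows "\<alpha> * a ^ 3 = - (1 - \<alpha>) * b ^ 3 \<longleftrightarrow> a = - root 3 ((1 - \<alpha>) / \<alpha>) * b"
proof -
  have "\<alpha> * a ^ 3 = - (1 - \<alpha>) * b ^ 3 \<longleftrightarrow> a ^ 3 = - ((1 - \<alpha>) / \<alpha>) * b ^ 3"
    using assms by (simp add: field_simps)
  also have "- ((1 - \<alpha>) / \<alpha>) * b ^ 3 = (- root 3 ((1 - \<alpha>) / \<alpha>) * b) ^ 3"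
    by (simp add: power_mult_distrib power_minus_odd odd_real_root_pow)
  \<comment> \<open>Cubing is injective on the reals, so the signs of \<open>a\<close> and
    \<open>b\<close> do not matter.\<close>
  finally show ?thesis
    by (metis odd_numeral odd_real_root_power_cancel)
qed

end

text \<open>The converse excludes solutions at infinity: the co-normal condition leaves a single
  linear equation for \<open>k\<close>, which is unsolvable when its two \<open>k\<close>
  coefficients agree.\<close>

theorem theorem3p2:
  fixes S :: "(real^2) set" and \<gamma>1 \<gamma>2 :: "real \<Rightarrow> real^2"
    and I1 I2 :: "real set" and \<alpha> s t lam :: real
  assumes "smooth_oval S"
    and "0 < \<alpha>" and "\<alpha> < 1"
    and "regular_local_param S I1 \<gamma>1" and "t \<in> I1"
    and "regular_local_param S I2 \<gamma>2" and "s \<in> I2"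
    and "\<gamma>1 t \<noteq> \<gamma>2 s"
    and "bracket (cderiv \<gamma>1 t) (cderiv \<gamma>2 s) \<noteq> 0"
    and "lam = root 3 ((1 - \<alpha>) / \<alpha>)"
  shows "((\<exists>X. envelope_point \<alpha> \<gamma>1 \<gamma>2 s t X) \<longrightarrow>
           conormal \<gamma>1 t (chord \<gamma>1 \<gamma>2 s t) = - lam * conormal \<gamma>2 s (chord \<gamma>1 \<gamma>2 s t)) \<and>
         (\<not> envelope_point_at_infinity \<alpha> \<gamma>1 \<gamma>2 s t \<longrightarrow>
           ((\<exists>X. envelope_point \<alpha> \<gamma>1 \<gamma>2 s t X) \<longleftrightarrow>
             conormal \<gamma>1 t (chord \<gamma>1 \<gamma>2 s t) = - lam * conormal \<gamma>2 s (chord \<gamma>1 \<gamma>2 s t)))"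
proof -
  interpret nonparallel_pair \<gamma>1 \<gamma>2 s t
    using assms smooth_curve_onD[of I1 \<gamma>1 t] smooth_curve_onD[of I2 \<gamma>2 s]
      oval_no_inflection[of S I1 \<gamma>1 t] oval_no_inflection[of S I2 \<gamma>2 s]
    by unfold_locales (auto simp: regular_local_param_def)
  have \<alpha>: "\<alpha> \<noteq> 0" "\<alpha> \<noteq> 1"
    using assms by auto
  show ?thesis
    using envelope_point_imp_cubes[OF _ \<alpha>] cubes_imp_envelope_point[OF _ \<alpha>]
      cubes_iff[OF assms(2,3)] assms(10) by metis
qed

end
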